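(* Let $K$ be a field, let $n \ge 1$, and let $A \in K^{n \times n}$. Then $A = F_p$ for some $p \in K^n$ if and only if $$[g, Ag, \dots, A^{n-1} g]\, b = [b, Ab, \dots, A^{n-1} b]\, g \quad \text{for all } b, g \in K^n.$$
   Context: For $p = [p_0, p_1, \dots, p_{n-1}]^T \in K^n$, the second companion matrix (companion matrix of the second type) associated with $p$ is $$F_p = \begin{bmatrix} 0 & 0 & \cdots & 0 & p_0 \\ 1 & 0 & \cdots & 0 & p_1 \\ 0 & 1 & \ddots & \vdots & \vdots \\ \vdots & & \ddots & 0 & p_{n-2} \\ 0 & 0 & \cdots & 1 & p_{n-1} \end{bmatrix} \in K^{n \times n},$$ i.e. with the standard unit vectors $e_0, \dots, e_{n-1}$ of $K^n$, $F_p e_i = e_{i+1}$ for $0 \le i \le n-2$ and $F_p e_{n-1} = p$. For $v \in K^n$, $[v, Av, \dots, A^{n-1}v]$ denotes the $n \times n$ matrix with columns $v, Av, \dots, A^{n-1}v$. *)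

theory Defs
  imports "Jordan_Normal_Form.Matrix"
begin

(* Indices start at 0. The test for the last column comes first, so that for
   dimension 1 the matrix is [p_0]. *)
definition second_companion_mat :: "'a :: zero_neq_one vec \<Rightarrow> 'a mat" where
  "second_companion_mat p = mat (dim_vec p) (dim_vec p)
     (\<lambda>(i, j). if j = dim_vec p - 1 then p $ i else if i = j + 1 then 1 else 0)"

definition krylov_mat :: "'a :: semiring_1 mat \<Rightarrow> 'a vec \<Rightarrow> 'a mat" where
  "krylov_mat A v = mat_of_cols (dim_vec v) (map (\<lambda>k. (A ^\<^sub>m k) *\<^sub>v v) [0..<dim_vec v])"

end

theory Submission
  imports Defs
begin

text \<open>
  Both conditions say that \<open>A ^ k e\<^sub>0 = e\<^sub>k\<close> for all \<open>k < n\<close>. Given this, column \<open>j\<close> of \<open>A ^ k\<close> is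
  \<open>A ^ (k + j) e\<^sub>0\<close>, which is symmetric in \<open>j\<close> and \<open>k\<close>, so the two Krylov products agree term by term.
  Conversely, for \<open>g = e\<^sub>0\<close> and \<open>b = e\<^sub>k\<close> the Krylov identity reads \<open>A ^ k e\<^sub>0 = e\<^sub>k\<close>.
\<close>

lemma second_companion_mat_carrier:
  "p \<in> carrier_vec n \<Longrightarrow> second_companion_mat p \<in> carrier_mat n n"
  by (simp add: second_companion_mat_def)

lemma col_second_companion_mat:
  assumes "p \<in> carrier_vec n" and "Suc j < n"
  shows "col (second_companion_mat p) j = unit_vec n (Suc j)"
  using assms by (intro eq_vecI) (auto simp: second_companion_mat_def unit_vec_def)

lemma last_col_second_companion_mat:
  assumes "p \<in> carrier_vec n" and "n \<ge> 1"
  shows "col (second_companion_mat p) (n - 1) = p"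
  using assms by (intro eq_vecI) (auto simp: second_companion_mat_def)

lemma mult_mat_unit_vec:
  fixes A :: "'a :: semiring_1 mat"
  assumes "A \<in> carrier_mat m n" and "j < n"
  shows "A *\<^sub>v unit_vec n j = col A j"
  using assms by (intro eq_vecI) auto

text \<open>Powers unfold with the new factor on the right, so the induction on \<open>l\<close>
  passes from \<open>v\<close> to \<open>A\<close> times \<open>v\<close>; hence \<open>v\<close> is
  generalized.\<close>

lemma pow_mat_add_mult_vec:
  fixes A :: "'a :: semiring_1 mat"
  assumes A: "A \<in> carrier_mat n n" and v: "v \<in> carrier_vec n"
  shows "A ^\<^sub>m (k + l) *\<^sub>v v = A ^\<^sub>m k *\<^sub>v (A ^\<^sub>m l *\<^sub>v v)"
  using v
proof (induction l arbitrary: v)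
  case 0
  then show ?case using A by simp
next
  case (Suc l)
  have "A ^\<^sub>m m *\<^sub>v (A *\<^sub>v v) = A ^\<^sub>m Suc m *\<^sub>v v" for m
    using A Suc.prems by (simp add: assoc_mult_mat_vec[of "A ^\<^sub>m m" n n A n])
  then show ?case
    using Suc.IH[of "A *\<^sub>v v"] A Suc.prems by (simp del: pow_mat.simps)
qed

text \<open>With the new factor on the left instead, the vectors A^k v become the iterates of
  \<open>A\<close> on \<open>v\<close>.\<close>

lemma pow_mat_Suc_mult_vec:
  fixes A :: "'a :: semiring_1 mat"
  assumes "A \<in> carrier_mat n n" and "v \<in> carrier_vec n"
  shows "A ^\<^sub>m Suc k *\<^sub>v v = A *\<^sub>v (A ^\<^sub>m k *\<^sub>v v)"
  using pow_mat_add_mult_vec[OF assms, of 1 k] assms(1) by simp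

text \<open>All columns but the last prescribe A e_j = e_(j+1), so the orbit of e_0 runs through the
  unit vectors in order. The last column is free, and it is \<open>p\<close>.\<close>

lemma second_companion_mat_iff_pow_unit_vec:
  fixes A :: "'a :: field mat"
  assumes n: "n \<ge> 1" and A: "A \<in> carrier_mat n n"
  shows "(\<exists>p \<in> carrier_vec n. A = second_companion_mat p) \<longleftrightarrow>
    (\<forall>k<n. A ^\<^sub>m k *\<^sub>v unit_vec n 0 = unit_vec n k)"
proof
  assume "\<exists>p \<in> carrier_vec n. A = second_companion_mat p"
  then obtain p where p: "p \<in> carrier_vec n" and Ap: "A = second_companion_mat p" by blast
  have "k < n \<Longrightarrow> A ^\<^sub>m k *\<^sub>v unit_vec n 0 = unit_vec n k" for k
  proof (induction k)
    case 0
    then show ?case using A by simp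
  next
    \<comment> \<open>A^(k+1) e_0 = A e_k is column k of \<open>A\<close>. Since k + 1 < n, this is
      not the last column, so it equals e_(k+1).\<close>
    case (Suc k)
    then show ?case
      using pow_mat_Suc_mult_vec[OF A, of "unit_vec n 0" k] col_second_companion_mat[OF p Suc.prems]
      by (simp add: mult_mat_unit_vec[OF A] Ap[symmetric] del: pow_mat.simps)
  qed
  then show "\<forall>k<n. A ^\<^sub>m k *\<^sub>v unit_vec n 0 = unit_vec n k" by blast
next
  assume pow: "\<forall>k<n. A ^\<^sub>m k *\<^sub>v unit_vec n 0 = unit_vec n k"
  \<comment> \<open>This choice is forced: \<open>p\<close> is the last column of any second
    companion matrix, and \<open>pow\<close> fixes only the columns before it.\<close>
  define p where "p = col A (n - 1)"
  have p: "p \<in> carrier_vec n" using A by (auto simp: p_def)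
  \<comment> \<open>A e_j = A (A^j e_0) = A^(j+1) e_0 = e_(j+1), with \<open>pow\<close> used at
    both j and j + 1.\<close>
  have col: "col A j = unit_vec n (Suc j)" if "Suc j < n" for j
    using that pow pow_mat_Suc_mult_vec[OF A, of "unit_vec n 0" j]
    by (simp del: pow_mat.simps add: mult_mat_unit_vec[OF A])
  have "A = second_companion_mat p"
  proof (rule mat_col_eqI)
    fix j assume "j < dim_col (second_companion_mat p)"
    then have j: "j < n" using second_companion_mat_carrier[OF p] by simp
    show "col A j = col (second_companion_mat p) j"
    proof (cases "Suc j < n")
      case True
      then show ?thesis by (simp add: col col_second_companion_mat[OF p])
    next
      case False
      with j have "j = n - 1" by simp
      then show ?thesis
        using last_col_second_companion_mat[OF p] n by (simp add: p_def)
    qed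
  qed (use A second_companion_mat_carrier[OF p] in auto)
  with p show "\<exists>p \<in> carrier_vec n. A = second_companion_mat p" by blast
qed

text \<open>In this expansion, exchanging \<open>v\<close> and \<open>b\<close> amounts to
  exchanging j and k in the matrix entry.\<close>

lemma krylov_mat_mult_vec_index:
  assumes A: "A \<in> carrier_mat n n" and v: "v \<in> carrier_vec n" and b: "b \<in> carrier_vec n"
    and i: "i < n"
  shows "(krylov_mat A v *\<^sub>v b) $ i = (\<Sum>k<n. \<Sum>j<n. (A ^\<^sub>m k) $$ (i, j) * v $ j * b $ k)"
proof -
  have "(krylov_mat A v *\<^sub>v b) $ i = (\<Sum>k<n. (A ^\<^sub>m k *\<^sub>v v) $ i * b $ k)"
    using assms
    by (simp add: krylov_mat_def mat_of_cols_index scalar_prod_def atLeast0LessThan)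
  also have "\<dots> = (\<Sum>k<n. \<Sum>j<n. (A ^\<^sub>m k) $$ (i, j) * v $ j * b $ k)"
  proof (rule sum.cong)
    fix k
    have "A ^\<^sub>m k \<in> carrier_mat n n" using A by simp
    then show "(A ^\<^sub>m k *\<^sub>v v) $ i * b $ k = (\<Sum>j<n. (A ^\<^sub>m k) $$ (i, j) * v $ j * b $ k)"
      using A v i
      by (auto simp: scalar_prod_def atLeast0LessThan sum_distrib_right simp del: pow_mat_dim
          intro!: sum.cong)
  qed simp
  finally show ?thesis .
qed

lemma krylov_mat_carrier:
  "v \<in> carrier_vec n \<Longrightarrow> krylov_mat A v \<in> carrier_mat n n"
  by (simp add: krylov_mat_def carrier_matI)

text \<open>This reads off column k, which lets the Krylov identity be tested on unit
  vectors.\<close>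

lemma krylov_mat_mult_unit_vec:
  assumes "A \<in> carrier_mat n n" and "v \<in> carrier_vec n" and "k < n"
  shows "krylov_mat A v *\<^sub>v unit_vec n k = A ^\<^sub>m k *\<^sub>v v"
proof -
  have "A ^\<^sub>m k *\<^sub>v v \<in> carrier_vec n"
    using assms by (intro mult_mat_vec_carrier[of _ n n]) auto
  then have "col (krylov_mat A v) k = A ^\<^sub>m k *\<^sub>v v"
    using assms by (simp add: krylov_mat_def)
  then show ?thesis
    using assms mult_mat_unit_vec[OF krylov_mat_carrier] by metis
qed

text \<open>The Krylov product is bilinear in \<open>g\<close> and \<open>b\<close>, with value A^k
  e_j at g = e_j, b = e_k. Symmetry thus means A^k e_j = A^j e_k for all j, k < n; the case j = 0 is
  the right-hand side and implies the others.\<close>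

lemma krylov_mat_symmetric_iff_pow_unit_vec:
  fixes A :: "'a :: field mat"
  assumes n: "n \<ge> 1" and A: "A \<in> carrier_mat n n"
  shows "(\<forall>b \<in> carrier_vec n. \<forall>g \<in> carrier_vec n.
      krylov_mat A g *\<^sub>v b = krylov_mat A b *\<^sub>v g) \<longleftrightarrow>
    (\<forall>k<n. A ^\<^sub>m k *\<^sub>v unit_vec n 0 = unit_vec n k)"
proof
  assume sym: "\<forall>b \<in> carrier_vec n. \<forall>g \<in> carrier_vec n.
    krylov_mat A g *\<^sub>v b = krylov_mat A b *\<^sub>v g"
  show "\<forall>k<n. A ^\<^sub>m k *\<^sub>v unit_vec n 0 = unit_vec n k"
  proof (intro allI impI)
    fix k assume k: "k < n"
    have "A ^\<^sub>m k *\<^sub>v unit_vec n 0 = krylov_mat A (unit_vec n 0) *\<^sub>v unit_vec n k"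
      using krylov_mat_mult_unit_vec[OF A _ k] by simp
    also have "\<dots> = krylov_mat A (unit_vec n k) *\<^sub>v unit_vec n 0"
      using sym by simp
    \<comment> \<open>Column 0 of a Krylov matrix is its starting vector, as A^0 is the identity;
      that column exists because n \<ge> 1.\<close>
    also have "\<dots> = unit_vec n k"
      using krylov_mat_mult_unit_vec[OF A, of "unit_vec n k" 0] n A by simp
    finally show "A ^\<^sub>m k *\<^sub>v unit_vec n 0 = unit_vec n k" .
  qed
next
  assume pow: "\<forall>k<n. A ^\<^sub>m k *\<^sub>v unit_vec n 0 = unit_vec n k"
  \<comment> \<open>Only e_j is replaced by A^j e_0, so k is arbitrary and k + j may exceed n -
    1.\<close>
  have col: "col (A ^\<^sub>m k) j = A ^\<^sub>m (k + j) *\<^sub>v unit_vec n 0" if "j < n" for j k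
  proof -
    have "col (A ^\<^sub>m k) j = A ^\<^sub>m k *\<^sub>v (A ^\<^sub>m j *\<^sub>v unit_vec n 0)"
      using that pow A by (simp add: mult_mat_unit_vec[of _ n n])
    also have "\<dots> = A ^\<^sub>m (k + j) *\<^sub>v unit_vec n 0"
      using A by (simp add: pow_mat_add_mult_vec)
    finally show ?thesis .
  qed
  \<comment> \<open>Both columns equal A^(k+j) e_0; here k < n is required as well, since k becomes
    a column index.\<close>
  have entry: "(A ^\<^sub>m k) $$ (i, j) = (A ^\<^sub>m j) $$ (i, k)" if "i < n" "j < n" "k < n" for i j k
  proof -
    have "col (A ^\<^sub>m k) j = col (A ^\<^sub>m j) k"
      using that by (simp add: col add.commute)
    then have "col (A ^\<^sub>m k) j $ i = col (A ^\<^sub>m j) k $ i" by simp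
    then show ?thesis using that A by (simp del: pow_mat_dim)
  qed
  show "\<forall>b \<in> carrier_vec n. \<forall>g \<in> carrier_vec n.
    krylov_mat A g *\<^sub>v b = krylov_mat A b *\<^sub>v g"
  proof (intro ballI eq_vecI)
    fix b g :: "'a vec" and i
    assume b: "b \<in> carrier_vec n" and g: "g \<in> carrier_vec n"
      and "i < dim_vec (krylov_mat A b *\<^sub>v g)"
    then have i: "i < n" using krylov_mat_carrier[OF b, of A] by simp
    have "(krylov_mat A g *\<^sub>v b) $ i = (\<Sum>k<n. \<Sum>j<n. (A ^\<^sub>m k) $$ (i, j) * g $ j * b $ k)"
      by (rule krylov_mat_mult_vec_index[OF A g b i])
    also have "\<dots> = (\<Sum>j<n. \<Sum>k<n. (A ^\<^sub>m k) $$ (i, j) * g $ j * b $ k)"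
      by (rule sum.swap)
    \<comment> \<open>After the swap, \<open>entry\<close> and commutativity of the field give the
      expansion with \<open>b\<close> and \<open>g\<close> exchanged.\<close>
    also have "\<dots> = (\<Sum>j<n. \<Sum>k<n. (A ^\<^sub>m j) $$ (i, k) * b $ k * g $ j)"
      using entry[OF i] by (intro sum.cong) (auto simp: mult_ac)
    also have "\<dots> = (krylov_mat A b *\<^sub>v g) $ i"
      by (rule krylov_mat_mult_vec_index[OF A b g i, symmetric])
    finally show "(krylov_mat A g *\<^sub>v b) $ i = (krylov_mat A b *\<^sub>v g) $ i" .
  next
    fix b g :: "'a vec"
    assume "b \<in> carrier_vec n" "g \<in> carrier_vec n"
    then show "dim_vec (krylov_mat A g *\<^sub>v b) = dim_vec (krylov_mat A b *\<^sub>v g)"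
      by (simp add: krylov_mat_def)
  qed
qed

theorem theorem2p2:
  fixes A :: "'a :: field mat" and n :: nat
  assumes "n \<ge> 1" and "A \<in> carrier_mat n n"
  shows "(\<exists>p \<in> carrier_vec n. A = second_companion_mat p) \<longleftrightarrow>
    (\<forall>b \<in> carrier_vec n. \<forall>g \<in> carrier_vec n.
       krylov_mat A g *\<^sub>v b = krylov_mat A b *\<^sub>v g)"
  using second_companion_mat_iff_pow_unit_vec[OF assms]
    krylov_mat_symmetric_iff_pow_unit_vec[OF assms] by simp

end
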